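(* Let $\mathcal{G}=(G_0,\dots,G_{p-1})$ be a periodic graph with footprint $G$ and let $h:G\to H$ be a retraction of $G$ onto a subgraph $H$. If for every time $t$, $h(G_t)$ is a retract of $G_t$, then $c(\mathcal{G}[H])\le c(\mathcal{G})$.
   Context: All graphs are finite, undirected and reflexive. A retraction of a graph $G$ onto a subgraph $H$ is a graph homomorphism $h:G\to H$ (edges map to edges, loops allowed as images) that is the identity on $H$; $H$ is a retract of $G$; $h(G_t)$ denotes the image of the subgraph $G_t$ under $h$. A periodic graph with period $p\ge1$ is a sequence $\mathcal{G}=(G_0,\dots,G_{p-1})$ of graphs $G_i=(V,E_i)$ on a common vertex set, extended by $G_{i+p}=G_i$; its footprint is $G=(V,\bigcup_iE_i)$, assumed connected. For $H\subseteq G$, $\mathcal{G}[H]=(G_0[V(H)],\dots,G_{p-1}[V(H)])$. Cops and Robber on a periodic graph with $k$ cops (perfect information): cops choose starting vertices, then the robber; in each round $t=0,1,\dots$ each cop moves to a vertex of $N_{G_{t\bmod p}}[\text{its position}]$, then the robber likewise; the cops win if a cop ever moves onto the robber's vertex. The cop number $c(\cdot)$ is the least $k$ such that $k$ cops have a winning strategy. *)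

theory Defs
  imports "Graph_Theory.Graph_Theory"
begin

text \<open>
  Undirected graphs are symmetric digraphs without parallel arcs: an edge \<open>uv\<close> is the pair of
  arcs \<open>(u, v)\<close> and \<open>(v, u)\<close>.
\<close>

locale reflexive_graph = pair_pseudo_graph +
  assumes loops: "v \<in> pverts G \<Longrightarrow> (v, v) \<in> parcs G"

definition closed_nbhd :: "'a pair_pre_digraph \<Rightarrow> 'a \<Rightarrow> 'a set" where
  "closed_nbhd G v = insert v {w. (v, w) \<in> parcs G}"

definition induce :: "'a pair_pre_digraph \<Rightarrow> 'a set \<Rightarrow> 'a pair_pre_digraph" where
  "induce G X = \<lparr> pverts = pverts G \<inter> X, parcs = parcs G \<inter> X \<times> X \<rparr>"

definition image_graph :: "('a \<Rightarrow> 'b) \<Rightarrow> 'a pair_pre_digraph \<Rightarrow> 'b pair_pre_digraph" where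
  "image_graph h G = \<lparr> pverts = h ` pverts G, parcs = map_prod h h ` parcs G \<rparr>"

definition graph_hom :: "('a \<Rightarrow> 'b) \<Rightarrow> 'a pair_pre_digraph \<Rightarrow> 'b pair_pre_digraph \<Rightarrow> bool" where
  "graph_hom h G H \<longleftrightarrow>
     (\<forall>v \<in> pverts G. h v \<in> pverts H) \<and> (\<forall>(u, v) \<in> parcs G. (h u, h v) \<in> parcs H)"

definition graph_retraction ::
    "('a \<Rightarrow> 'a) \<Rightarrow> 'a pair_pre_digraph \<Rightarrow> 'a pair_pre_digraph \<Rightarrow> bool" where
  "graph_retraction h G H \<longleftrightarrow> subgraph H G \<and> graph_hom h G H \<and> (\<forall>v \<in> pverts H. h v = v)"

definition graph_retract_of :: "'a pair_pre_digraph \<Rightarrow> 'a pair_pre_digraph \<Rightarrow> bool" where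
  "graph_retract_of H G \<longleftrightarrow> (\<exists>h. graph_retraction h G H)"


text \<open>
  A periodic graph is the list \<open>[G\<^sub>0, \<dots>, G\<^sub>p\<^sub>-\<^sub>1]\<close>; its period is the length of the list.
\<close>

definition graph_at :: "'a pair_pre_digraph list \<Rightarrow> nat \<Rightarrow> 'a pair_pre_digraph" where
  "graph_at Gs t = Gs ! (t mod length Gs)"

definition footprint :: "'a pair_pre_digraph list \<Rightarrow> 'a pair_pre_digraph" where
  "footprint Gs = \<lparr> pverts = (\<Union>G \<in> set Gs. pverts G), parcs = (\<Union>G \<in> set Gs. parcs G) \<rparr>"

text \<open>
  The library's \<^const>\<open>connected\<close> excludes the graph without vertices.
\<close>

definition periodic_graph :: "'a pair_pre_digraph list \<Rightarrow> bool" where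
  "periodic_graph Gs \<longleftrightarrow>
     Gs \<noteq> [] \<and>
     (\<forall>G \<in> set Gs. reflexive_graph G) \<and>
     (\<exists>V. \<forall>G \<in> set Gs. pverts G = V) \<and>
     connected (footprint Gs)"

definition induce_periodic ::
    "'a pair_pre_digraph list \<Rightarrow> 'a set \<Rightarrow> 'a pair_pre_digraph list" where
  "induce_periodic Gs X = map (\<lambda>G. induce G X) Gs"


text \<open>
  In the game, \<open>c t\<close> lists the positions of the cops and \<open>r t\<close> is the position of the robber at the
  beginning of round \<open>t\<close>. In round \<open>t\<close> the cops first move from \<open>c t\<close> to \<open>c (Suc t)\<close>, and then the
  robber moves from \<open>r t\<close> to \<open>r (Suc t)\<close>, both in \<open>graph_at Gs t\<close>. Hence the robber is caught in
  round \<open>t\<close> iff \<open>r t\<close> occurs in \<open>c (Suc t)\<close>. Plays are continued forever even after a capture, which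
  is harmless since players may always stay put.
\<close>

definition cop_play :: "'a pair_pre_digraph list \<Rightarrow> nat \<Rightarrow> (nat \<Rightarrow> 'a list) \<Rightarrow> bool" where
  "cop_play Gs k c \<longleftrightarrow>
     length (c 0) = k \<and> set (c 0) \<subseteq> pverts (graph_at Gs 0) \<and>
     (\<forall>t. list_all2 (\<lambda>u v. v \<in> closed_nbhd (graph_at Gs t) u) (c t) (c (Suc t)))"

definition robber_play :: "'a pair_pre_digraph list \<Rightarrow> (nat \<Rightarrow> 'a) \<Rightarrow> bool" where
  "robber_play Gs r \<longleftrightarrow>
     r 0 \<in> pverts (graph_at Gs 0) \<and>
     (\<forall>t. r (Suc t) \<in> closed_nbhd (graph_at Gs t) (r t))"

text \<open>
  A strategy of the cops maps the robber's positions \<open>[r 0, \<dots>, r (t - 1)]\<close> observed so far to the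
  cops' positions \<open>c t\<close>; in particular the starting positions are its value at \<open>[]\<close>. The cops' own
  earlier positions need not be an argument, as the strategy itself determines them from the
  robber's. For the same reason quantifying over all plays of the robber covers every (adaptive)
  behaviour of the robber.
\<close>

definition cops_follow :: "('a list \<Rightarrow> 'a list) \<Rightarrow> (nat \<Rightarrow> 'a) \<Rightarrow> nat \<Rightarrow> 'a list" where
  "cops_follow \<sigma> r t = \<sigma> (map r [0..<t])"

definition winning_strategy ::
    "'a pair_pre_digraph list \<Rightarrow> nat \<Rightarrow> ('a list \<Rightarrow> 'a list) \<Rightarrow> bool" where
  "winning_strategy Gs k \<sigma> \<longleftrightarrow>
     (\<forall>r. robber_play Gs r \<longrightarrow>
        cop_play Gs k (cops_follow \<sigma> r) \<and> (\<exists>t. r t \<in> set (cops_follow \<sigma> r (Suc t))))"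

definition cops_win :: "'a pair_pre_digraph list \<Rightarrow> nat \<Rightarrow> bool" where
  "cops_win Gs k \<longleftrightarrow> (\<exists>\<sigma>. winning_strategy Gs k \<sigma>)"

definition cop_number :: "'a pair_pre_digraph list \<Rightarrow> nat" where
  "cop_number Gs = (LEAST k. cops_win Gs k)"

text \<open>
  The minimum is attained, since one cop on each vertex suffices.
\<close>

lemma cops_win_card:
  assumes "finite (pverts (graph_at Gs 0))"
  shows "cops_win Gs (card (pverts (graph_at Gs 0)))"
proof -
  obtain vs where vs: "set vs = pverts (graph_at Gs 0)" "distinct vs"
    using assms finite_distinct_list by blast
  have "winning_strategy Gs (length vs) (\<lambda>_. vs)"
    unfolding winning_strategy_def
  proof (intro allI impI conjI)
    fix r assume r: "robber_play Gs r"
    show "cop_play Gs (length vs) (cops_follow (\<lambda>_. vs) r)"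
      by (simp add: cop_play_def cops_follow_def closed_nbhd_def vs list_all2_same)
    from r show "\<exists>t. r t \<in> set (cops_follow (\<lambda>_. vs) r (Suc t))"
      by (auto simp: robber_play_def cops_follow_def vs)
  qed
  then show ?thesis
    using vs by (metis cops_win_def distinct_card)
qed

lemma cops_win_cop_number:
  assumes "finite (pverts (graph_at Gs 0))"
  shows "cops_win Gs (cop_number Gs)"
  unfolding cop_number_def using cops_win_card[OF assms] by (rule LeastI)

end

theory Submission
  imports Defs
begin

text \<open>
  Since \<open>h(G\<^sub>t)\<close> is a subgraph of \<open>G\<^sub>t\<close>, the map \<open>h\<close> sends arcs of \<open>G\<^sub>t\<close> to arcs of
  \<open>G\<^sub>t[V(H)]\<close>. Hence \<open>k\<close> cops win on \<open>\<G>[H]\<close> by playing the images under \<open>h\<close> of their winning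
  moves on \<open>\<G>\<close>: the robber on \<open>\<G>[H]\<close> is also a robber on \<open>\<G>\<close>, and as \<open>h\<close> fixes his
  position, his capture is preserved by \<open>h\<close>.
\<close>

lemma pair_subgraphD:
  fixes G H :: "'a pair_pre_digraph"
  assumes "subgraph H G"
  shows "pverts H \<subseteq> pverts G" "parcs H \<subseteq> parcs G"
  using assms by (auto simp: subgraph_def)

lemma graph_at_in_set: "Gs \<noteq> [] \<Longrightarrow> graph_at Gs t \<in> set Gs"
  by (simp add: graph_at_def)

lemma graph_at_induce_periodic:
  "Gs \<noteq> [] \<Longrightarrow> graph_at (induce_periodic Gs X) t = induce (graph_at Gs t) X"
  by (simp add: graph_at_def induce_periodic_def)

lemma closed_nbhd_induce_subset: "closed_nbhd (induce G X) v \<subseteq> closed_nbhd G v"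
  by (auto simp: closed_nbhd_def induce_def)

text \<open>A move along an arc maps to a move along the image arc, and staying put maps to staying
  put, as \<open>closed_nbhd\<close> contains its centre by definition.\<close>

lemma graph_hom_closed_nbhd:
  assumes "graph_hom f G H" "w \<in> closed_nbhd G v"
  shows "f w \<in> closed_nbhd H (f v)"
  using assms by (auto simp: graph_hom_def closed_nbhd_def)

lemma robber_play_induce_periodic:
  assumes "Gs \<noteq> []" "robber_play (induce_periodic Gs X) r"
  shows "robber_play Gs r"
  using assms closed_nbhd_induce_subset
  by (fastforce simp: robber_play_def graph_at_induce_periodic induce_def)

text \<open>The start lies in \<open>X\<close>; afterwards the robber either stays or follows an arc
  with both ends in \<open>X\<close>, so membership persists by induction.\<close>

lemma robber_play_induce_periodic_in:
  assumes "Gs \<noteq> []" "robber_play (induce_periodic Gs X) r"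
  shows "r t \<in> X"
proof (induction t)
  case 0
  then show ?case
    using assms by (simp add: robber_play_def graph_at_induce_periodic induce_def)
next
  case (Suc t)
  have "r (Suc t) \<in> closed_nbhd (induce (graph_at Gs t) X) (r t)"
    using assms by (simp add: robber_play_def graph_at_induce_periodic)
  with Suc show ?case
    by (auto simp: closed_nbhd_def induce_def)
qed

text \<open>The same \<open>f\<close> must serve at all times: the position reached in one round is
  the point of departure in the next, so the mapped moves fit together.\<close>

lemma cop_play_map:
  assumes "\<And>t. graph_hom f (graph_at Gs t) (graph_at Hs t)" "cop_play Gs k c"
  shows "cop_play Hs k (\<lambda>t. map f (c t))"
  unfolding cop_play_def
proof (intro conjI allI)
  show "length (map f (c 0)) = k"
    using assms(2) by (simp add: cop_play_def)
  show "set (map f (c 0)) \<subseteq> pverts (graph_at Hs 0)"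
    using assms(1)[of 0] assms(2) by (auto simp: cop_play_def graph_hom_def)
next
  fix t
  have "list_all2 (\<lambda>u v. v \<in> closed_nbhd (graph_at Gs t) u) (c t) (c (Suc t))"
    using assms(2) by (simp add: cop_play_def)
  then show "list_all2 (\<lambda>u v. v \<in> closed_nbhd (graph_at Hs t) u)
      (map f (c t)) (map f (c (Suc t)))"
    unfolding list.rel_map
    by (rule list.rel_mono_strong) (rule graph_hom_closed_nbhd[OF assms(1)])
qed

lemma cops_win_induce_periodic:
  assumes "Gs \<noteq> []"
    and hom: "\<And>t. graph_hom h (graph_at Gs t) (induce (graph_at Gs t) X)"
    and fixed: "\<And>v. v \<in> X \<Longrightarrow> h v = v"
    and "cops_win Gs k"
  shows "cops_win (induce_periodic Gs X) k"
proof -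
  from \<open>cops_win Gs k\<close> obtain \<sigma> where \<sigma>: "winning_strategy Gs k \<sigma>"
    by (auto simp: cops_win_def)
  \<comment> \<open>Only the output of \<open>\<sigma>\<close> is mapped. Its input, the robber's
    history, is passed on unchanged because it is already a history on \<open>Gs\<close>.\<close>
  have follow: "cops_follow (map h \<circ> \<sigma>) r = (\<lambda>t. map h (cops_follow \<sigma> r t))" for r
    by (simp add: cops_follow_def fun_eq_iff)
  have "winning_strategy (induce_periodic Gs X) k (map h \<circ> \<sigma>)"
    unfolding winning_strategy_def follow
  proof (intro allI impI conjI)
    fix r assume r: "robber_play (induce_periodic Gs X) r"
    have play: "cop_play Gs k (cops_follow \<sigma> r)"
      and "\<exists>t. r t \<in> set (cops_follow \<sigma> r (Suc t))"
      using \<sigma> robber_play_induce_periodic[OF \<open>Gs \<noteq> []\<close> r] by (auto simp: winning_strategy_def)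
    then obtain t where "r t \<in> set (cops_follow \<sigma> r (Suc t))"
      by blast
    moreover have "h (r t) = r t"
      using robber_play_induce_periodic_in[OF \<open>Gs \<noteq> []\<close> r] by (rule fixed)
    ultimately have "r t \<in> set (map h (cops_follow \<sigma> r (Suc t)))"
      by (metis image_eqI list.set_map)
    then show "\<exists>t. r t \<in> set (map h (cops_follow \<sigma> r (Suc t)))" ..
    show "cop_play (induce_periodic Gs X) k (\<lambda>t. map h (cops_follow \<sigma> r t))"
      using hom play
      by (intro cop_play_map[of h Gs]) (simp_all add: graph_at_induce_periodic[OF \<open>Gs \<noteq> []\<close>])
  qed
  then show ?thesis
    by (auto simp: cops_win_def)
qed

theorem theorem2:
  fixes Gs :: "'a pair_pre_digraph list" and H :: "'a pair_pre_digraph" and h :: "'a \<Rightarrow> 'a"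
  assumes "periodic_graph Gs"
    and "reflexive_graph H"
    and "graph_retraction h (footprint Gs) H"
    and "\<And>t. graph_retract_of (image_graph h (graph_at Gs t)) (graph_at Gs t)"
  shows "cop_number (induce_periodic Gs (pverts H)) \<le> cop_number Gs"
proof -
  have ne: "Gs \<noteq> []"
    using assms(1) by (simp add: periodic_graph_def)
  have refl: "reflexive_graph (graph_at Gs t)" for t
    using assms(1) graph_at_in_set[OF ne] by (simp add: periodic_graph_def)
  have fixed: "h v = v" if "v \<in> pverts H" for v
    using assms(3) that by (simp add: graph_retraction_def)
  have hom: "graph_hom h (graph_at Gs t) (induce (graph_at Gs t) (pverts H))" for t
  proof -
    interpret reflexive_graph "graph_at Gs t"
      by (rule refl)
    \<comment> \<open>The retraction onto the image may differ from \<open>h\<close>; it supplies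
      the inclusion of the image in \<open>graph_at Gs t\<close>, which makes \<open>h\<close>
      itself an endomorphism of that graph.\<close>
    have "subgraph (image_graph h (graph_at Gs t)) (graph_at Gs t)"
      using assms(4)[of t] by (auto simp: graph_retract_of_def graph_retraction_def)
    from pair_subgraphD[OF this]
    have "\<And>v. v \<in> pverts (graph_at Gs t) \<Longrightarrow> h v \<in> pverts (graph_at Gs t)"
      and "\<And>u v. (u, v) \<in> parcs (graph_at Gs t) \<Longrightarrow> (h u, h v) \<in> parcs (graph_at Gs t)"
      by (force simp: image_graph_def)+
    moreover have "h v \<in> pverts H" if "v \<in> pverts (graph_at Gs t)" for v
      using assms(3) graph_at_in_set[OF ne] that
      by (auto simp: graph_retraction_def graph_hom_def footprint_def)
    \<comment> \<open>An arc of the induced graph needs both ends in \<open>pverts H\<close>: the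
      ends of an arc are vertices, and \<open>h\<close> sends every vertex into
      \<open>pverts H\<close>.\<close>
    ultimately show ?thesis
      by (auto simp: graph_hom_def induce_def dest: in_arcsD1 in_arcsD2)
  qed
  \<comment> \<open>Finiteness ensures that the \<open>LEAST\<close> defining
    \<open>cop_number Gs\<close> is attained, so there is a winning strategy to transfer.\<close>
  have "finite (pverts (graph_at Gs 0))"
  proof -
    interpret reflexive_graph "graph_at Gs 0"
      by (rule refl)
    show ?thesis
      by simp
  qed
  then have "cops_win Gs (cop_number Gs)"
    by (rule cops_win_cop_number)
  then have "cops_win (induce_periodic Gs (pverts H)) (cop_number Gs)"
    using cops_win_induce_periodic ne hom fixed by blast
  then show ?thesis
    unfolding cop_number_def[of "induce_periodic Gs (pverts H)"] by (rule Least_le)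
qed

end
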